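(* Let $(\boldsymbol s,\boldsymbol t)$ be a bipartite degree sequence, $X,L\subseteq K_{m,n}$ with $X\cap L=\boldsymbol{\emptyset}$, and $G\sim\mathcal B_{(\boldsymbol s,\boldsymbol t)}(\boldsymbol{\emptyset},L)$. Let $e_1,\dots,e_{m(X)}$ enumerate the edges of $X$, $X_0=\boldsymbol{\emptyset}$, $X_i=X_0+e_1+\dots+e_i$, and let $(\boldsymbol x,\boldsymbol y)$ be the degree sequence of $X$. (A) If $p(\boldsymbol s,\boldsymbol t,X_{i-1},L,e_i)>0$ for all $i$, then $$\mathbb P(X\subseteq G)\le\frac{\prod_{i\in S}[s_i]_{x_i}\prod_{j\in T}[t_j]_{y_j}}{[m(G)]_{m(X)}}\cdot\prod_{i=1}^{m(X)}\frac{1}{p(\boldsymbol s,\boldsymbol t,X_{i-1},L,e_i)}.$$ (B) If $q(\boldsymbol s,\boldsymbol t,X_{i-1},L,e_i)>0$ for all $i$, then $$\mathbb P(X\subseteq G)\ge\frac{\prod_{i\in S}[s_i]_{x_i}\prod_{j\in T}[t_j]_{y_j}}{[m(G)]_{m(X)}}\cdot\prod_{i=1}^{m(X)}\frac{q(\boldsymbol s,\boldsymbol t,X_{i-1},L,e_i)}{\phi'(X)},$$ where $\phi'(X)=1+\dfrac{\frac{1}{m(X)}\sum_{uv\in X}s_ut_v}{m(G)-m(X)}$.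
   Context: $K_{m,n}$ is the complete bipartite graph with parts $S=\{u_1,\dots,u_m\}$, $T=\{v_1,\dots,v_n\}$; edges $uv$ have $u\in S$, $v\in T$; graphs are subgraphs identified with edge sets, $\boldsymbol{\emptyset}$ the edgeless graph, $m(\cdot)$ the number of edges, $H+e$ adds edge $e$. Degree sequences $(\boldsymbol a,\boldsymbol b)$ have $\boldsymbol a$ indexed by $S$, $\boldsymbol b$ by $T$; a graph $H$ has $(\boldsymbol h,\boldsymbol i)$, $L$ has $(\boldsymbol l,\boldsymbol m)$ (bold $\boldsymbol m$ is a vector on $T$). $\mathcal B_{(\boldsymbol s,\boldsymbol t)}(X,Y)$ is the (assumed nonempty) set of $G\subseteq K_{m,n}$ with degree sequence $(\boldsymbol s,\boldsymbol t)$, $X\subseteq G$, $G\cap Y=\boldsymbol{\emptyset}$, uniformly distributed. $m(G):=\sum_{u\in S}s_u$. $[x]_i=\prod_{j=0}^{i-1}(x-j)$. Degree sum function: for a nonnegative integer vector $\boldsymbol g$ on a finite set with entries $g_{i_1}\ge\dots\ge g_{i_N}$ sorted, $L(\boldsymbol g,k)=\sum_{j\le k}g_{i_j}$, $D(\boldsymbol g,x)=g_{i_1}x$ ($x<1$), $g_{i_{k+1}}(x-k)+L(\boldsymbol g,k)$ ($x\in[k,k+1)$, $1\le k\le N-1$), $L(\boldsymbol g,N)$ ($x\ge N$). $S_H(x)=D(\boldsymbol s-\boldsymbol h,x)$, $T_H(x)=D(\boldsymbol t-\boldsymbol i,x)$. $\alpha_w(\boldsymbol n,\boldsymbol l,\boldsymbol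 g,\boldsymbol h)=D(\boldsymbol n+\boldsymbol l,\max\{g_w-h_w,1\})/\max\{g_w-h_w,1\}$ ($\boldsymbol n,\boldsymbol l$ on one vertex set, $\boldsymbol g,\boldsymbol h$ on another containing $w$). For $H\cap L=\boldsymbol\emptyset$, $uv\notin H\cup L$: $p(\boldsymbol s,\boldsymbol t,H,L,uv)=1-\dfrac{T_H(s_u+l_u)+S_H(t_v+m_v)}{m(G)-m(H)}$, $q(\boldsymbol s,\boldsymbol t,H,L,uv)=1-\dfrac{S_H(\alpha_u(\boldsymbol t,\boldsymbol m,\boldsymbol s,\boldsymbol h))+T_H(\alpha_v(\boldsymbol s,\boldsymbol l,\boldsymbol t,\boldsymbol i))}{m(G)-m(H)}$. *)

theory Defs
  imports "HOL-Probability.Probability"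
begin

text \<open>
  The parts of \<open>K\<^bsub>m,n\<^esub>\<close> are \<open>{1..m}\<close> and \<open>{1..n}\<close>; a graph is its set of edges \<open>(u, v)\<close>, where the
  first component always lies in \<open>S\<close> and the second in \<open>T\<close>, so the two parts are kept apart by
  position although both consist of natural numbers.
\<close>

type_synonym bgraph = "(nat \<times> nat) set"

definition K :: "nat \<Rightarrow> nat \<Rightarrow> bgraph" where
  "K m n = {1..m} \<times> {1..n}"

definition deg_S :: "bgraph \<Rightarrow> nat \<Rightarrow> nat" where
  "deg_S G u = card {v. (u, v) \<in> G}"

definition deg_T :: "bgraph \<Rightarrow> nat \<Rightarrow> nat" where
  "deg_T G v = card {u. (u, v) \<in> G}"

definition \<B> :: "nat \<Rightarrow> nat \<Rightarrow> (nat \<Rightarrow> nat) \<Rightarrow> (nat \<Rightarrow> nat) \<Rightarrow> bgraph \<Rightarrow> bgraph \<Rightarrow> bgraph set" where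
  "\<B> m n s t X Y = {G. G \<subseteq> K m n \<and> (\<forall>u\<in>{1..m}. deg_S G u = s u) \<and> (\<forall>v\<in>{1..n}. deg_T G v = t v)
     \<and> X \<subseteq> G \<and> G \<inter> Y = {}}"

definition num_edges :: "nat \<Rightarrow> (nat \<Rightarrow> nat) \<Rightarrow> nat" where
  "num_edges m s = (\<Sum>u=1..m. s u)"

definition falling :: "real \<Rightarrow> nat \<Rightarrow> real" where
  "falling x i = (\<Prod>j<i. x - real j)"

definition desc_entries :: "nat set \<Rightarrow> (nat \<Rightarrow> int) \<Rightarrow> int list" where
  "desc_entries V g = rev (sorted_list_of_multiset (image_mset g (mset_set V)))"

definition top_sum :: "nat set \<Rightarrow> (nat \<Rightarrow> int) \<Rightarrow> nat \<Rightarrow> int" where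
  "top_sum V g k = sum_list (take k (desc_entries V g))"

text \<open>
  The degree sum function of a vector indexed by the finite set \<open>V\<close>. List positions start at 0, so
  the \<open>(k+1)\<close>-st largest entry is at position \<open>k\<close>. The clause for \<open>x \<ge> card V\<close> is tested first; this
  only matters for empty \<open>V\<close>, which has no largest entry. Entries are integers, so that
  differences of degree vectors need no truncation; nonnegativity is not part of the definition.
\<close>

definition D :: "nat set \<Rightarrow> (nat \<Rightarrow> int) \<Rightarrow> real \<Rightarrow> real" where
  "D V g x =
    (if x \<ge> real (card V) then real_of_int (top_sum V g (card V))
     else if x < 1 then real_of_int (desc_entries V g ! 0) * x
     else (let k = nat \<lfloor>x\<rfloor> in
       real_of_int (desc_entries V g ! k) * (x - real k) + real_of_int (top_sum V g k)))"

definition S_sum :: "nat \<Rightarrow> (nat \<Rightarrow> nat) \<Rightarrow> bgraph \<Rightarrow> real \<Rightarrow> real" where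
  "S_sum m s H x = D {1..m} (\<lambda>u. int (s u) - int (deg_S H u)) x"

definition T_sum :: "nat \<Rightarrow> (nat \<Rightarrow> nat) \<Rightarrow> bgraph \<Rightarrow> real \<Rightarrow> real" where
  "T_sum n t H x = D {1..n} (\<lambda>v. int (t v) - int (deg_T H v)) x"

text \<open>
  In \<open>alpha V a l g h w\<close> the vectors \<open>a\<close>, \<open>l\<close> are indexed by \<open>V\<close>, while \<open>g\<close>, \<open>h\<close> are indexed by
  the other part, which contains \<open>w\<close>.
\<close>

definition alpha ::
  "nat set \<Rightarrow> (nat \<Rightarrow> nat) \<Rightarrow> (nat \<Rightarrow> nat) \<Rightarrow> (nat \<Rightarrow> nat) \<Rightarrow> (nat \<Rightarrow> nat) \<Rightarrow> nat \<Rightarrow> real" where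
  "alpha V a l g h w =
    D V (\<lambda>i. int (a i) + int (l i)) (max (real (g w) - real (h w)) 1)
      / max (real (g w) - real (h w)) 1"

fun p :: "nat \<Rightarrow> nat \<Rightarrow> (nat \<Rightarrow> nat) \<Rightarrow> (nat \<Rightarrow> nat) \<Rightarrow> bgraph \<Rightarrow> bgraph \<Rightarrow> nat \<times> nat \<Rightarrow> real" where
  "p m n s t H L (u, v) =
    1 - (T_sum n t H (real (s u) + real (deg_S L u)) + S_sum m s H (real (t v) + real (deg_T L v)))
      / (real (num_edges m s) - real (card H))"

fun q :: "nat \<Rightarrow> nat \<Rightarrow> (nat \<Rightarrow> nat) \<Rightarrow> (nat \<Rightarrow> nat) \<Rightarrow> bgraph \<Rightarrow> bgraph \<Rightarrow> nat \<times> nat \<Rightarrow> real" where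
  "q m n s t H L (u, v) =
    1 - (S_sum m s H (alpha {1..n} t (deg_T L) s (deg_S H) u)
         + T_sum n t H (alpha {1..m} s (deg_S L) t (deg_T H) v))
      / (real (num_edges m s) - real (card H))"

definition \<phi>' :: "nat \<Rightarrow> (nat \<Rightarrow> nat) \<Rightarrow> (nat \<Rightarrow> nat) \<Rightarrow> bgraph \<Rightarrow> real" where
  "\<phi>' m s t X =
    1 + (1 / real (card X) * (\<Sum>(u, v)\<in>X. real (s u) * real (t v)))
      / (real (num_edges m s) - real (card X))"

end

(*
  Conditioning on the edges of X one at a time reduces both bounds to the proportion of graphs in
  B(H, L) that contain a fixed edge uv. For the upper bound, a graph containing uv is switched along
  a 4-cycle: uv, xy are replaced by uy, xv. For the lower bound, a graph avoiding uv is switched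
  along a hexagon: uy, xz, wv are replaced by uv, xy, wz. The free third edge xz is what makes the
  second count possible: for fixed y the edges xz with xy in G or L number at most S_H(t_y + m_y),
  and by concavity of S_H the sum over the neighbours y of u is controlled by S_H(alpha_u).
  The lower bound produces denominators 1 + r_i with r_i <= s_u t_v / (m(G) - m(X)), which AM-GM
  merges into phi'. If m(G) = m(X), where phi' takes the junk value 1, then q <= 0 at the last edge.
*)

theory Submission
  imports Defs
begin

subsection \<open>Degree sum functions\<close>

text \<open>As \<open>c\<close> is the entry at position \<open>k\<close> of a descending list,
  earlier entries are at least \<open>c\<close> and later ones at most \<open>c\<close>. So only the
  first \<open>k\<close> terms can survive the truncation at 0.\<close>

lemma sum_list_max_desc:
  fixes xs :: "int list" and c :: real
  assumes "sorted (rev xs)" "k < length xs" "c = of_int (xs ! k)"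
  shows "(\<Sum>a\<leftarrow>xs. max (of_int a - c) 0) = of_int (sum_list (take k xs)) - real k * c"
proof -
  have ord: "xs ! j \<le> xs ! i" if "i \<le> j" "j < length xs" for i j
    using assms(1) that by (simp add: sorted_rev_nth_mono)
  have t: "(\<Sum>a\<leftarrow>take k xs. max (of_int a - c) 0) = (\<Sum>a\<leftarrow>take k xs. of_int a - c)"
  proof (intro arg_cong[of _ _ sum_list] map_cong refl)
    fix a assume "a \<in> set (take k xs)"
    then obtain i where "i < k" "a = xs ! i" by (auto simp: in_set_conv_nth)
    then show "max (real_of_int a - c) 0 = real_of_int a - c"
      using ord[of i k] assms by simp
  qed
  have d: "(\<Sum>a\<leftarrow>drop k xs. max (of_int a - c) 0) = (\<Sum>a\<leftarrow>drop k xs. 0)"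
    using ord assms by (intro arg_cong[of _ _ sum_list] map_cong refl) (auto simp: in_set_conv_nth max_def)
  have s: "(\<Sum>a\<leftarrow>ys. of_int a - c) = of_int (sum_list ys) - real (length ys) * c" for ys :: "int list"
    by (induction ys) (auto simp: algebra_simps)
  have "(\<Sum>a\<leftarrow>xs. max (of_int a - c) 0) = (\<Sum>a\<leftarrow>take k xs @ drop k xs. max (of_int a - c) 0)"
    by simp
  also have "\<dots> = of_int (sum_list (take k xs)) - real k * c"
    unfolding map_append sum_list_append t d s using assms(2) by simp
  finally show ?thesis .
qed

lemma sum_list_desc_entries:
  fixes f :: "int \<Rightarrow> 'a::comm_monoid_add"
  assumes "finite V"
  shows "(\<Sum>a\<leftarrow>desc_entries V g. f a) = (\<Sum>i\<in>V. f (g i))"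
proof -
  have "(\<Sum>a\<leftarrow>desc_entries V g. f a) = sum_mset (image_mset f (mset (desc_entries V g)))"
    by (metis mset_map sum_mset_sum_list)
  also have "\<dots> = (\<Sum>i\<in>V. f (g i))"
    by (simp add: desc_entries_def image_mset.compositionality sum_unfold_sum_mset o_def)
  finally show ?thesis .
qed

lemma length_desc_entries: "length (desc_entries V g) = card V"
  by (simp add: desc_entries_def flip: size_mset)

text \<open>The concave function \<open>D V g\<close> in dual form: at each point it agrees with one of its
  supporting lines, and the constant term of the line is a sum over \<open>V\<close>.\<close>

lemma D_dual:
  assumes "finite V" "\<And>i. i \<in> V \<Longrightarrow> 0 \<le> g i" "0 \<le> x"
  shows "\<exists>c\<ge>0. D V g x = c * x + (\<Sum>i\<in>V. max (of_int (g i) - c) 0)"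
proof (cases "x \<ge> real (card V)")
  case True
  have "(\<Sum>i\<in>V. max (real_of_int (g i)) 0) = (\<Sum>i\<in>V. real_of_int (g i))"
    using assms by (intro sum.cong) auto
  moreover have "top_sum V g (card V) = (\<Sum>i\<in>V. g i)"
    using sum_list_desc_entries[OF assms(1), of "\<lambda>a. a" g]
    by (simp add: top_sum_def length_desc_entries)
  ultimately show ?thesis
    \<comment> \<open>From \<open>card V\<close> on the function is constant, so the supporting line
      has slope 0.\<close>
    using True by (intro exI[of _ 0]) (simp add: D_def)
next
  case False
  define k where "k = nat \<lfloor>x\<rfloor>"
  \<comment> \<open>The slope of the linear piece of \<open>D V g\<close> over \<open>x\<close>: the
    entry that follows the \<open>k\<close> largest.\<close>
  define c where "c = real_of_int (desc_entries V g ! k)"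
  have k: "k < length (desc_entries V g)"
    unfolding length_desc_entries k_def using False assms(3) by linarith
  have "set (desc_entries V g) = g ` V"
    using assms(1) by (simp add: desc_entries_def)
  then have c0: "c \<ge> 0"
    using nth_mem[OF k] assms(2) by (auto simp: c_def)
  have "(\<Sum>i\<in>V. max (of_int (g i) - c) 0) = of_int (top_sum V g k) - real k * c"
    using sum_list_max_desc[OF _ k c_def] sum_list_desc_entries[OF assms(1), of "\<lambda>a. max (of_int a - c) 0" g]
    by (simp add: top_sum_def desc_entries_def)
  moreover have "D V g x = c * (x - real k) + of_int (top_sum V g k)"
  proof (cases "x < 1")
    case True
    \<comment> \<open>The clause of \<open>D\<close> for \<open>x < 1\<close> is the general formula
      at \<open>k = 0\<close>, where the partial sum is empty.\<close>
    then have "k = 0"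
      using assms(3) by (simp add: k_def)
    then show ?thesis
      using True False by (simp add: D_def c_def top_sum_def)
  next
    case 1: False
    then show ?thesis
      using False by (simp add: D_def c_def k_def Let_def)
  qed
  ultimately show ?thesis
    using c0 by (intro exI[of _ c]) (simp add: algebra_simps)
qed

text \<open>Each \<open>g i\<close> is at most \<open>c\<close> plus its excess over
  \<open>c\<close>, for any \<open>c\<close>. The excess is summed over all of \<open>V\<close>, so
  a single \<open>c\<close> can serve many sets \<open>A\<close> at once.\<close>

lemma sum_le_threshold:
  fixes g :: "'a \<Rightarrow> real"
  assumes "finite V" "A \<subseteq> V"
  shows "(\<Sum>i\<in>A. g i) \<le> c * real (card A) + (\<Sum>i\<in>V. max (g i - c) 0)"
proof -
  have "(\<Sum>i\<in>A. g i) \<le> (\<Sum>i\<in>A. c + max (g i - c) 0)"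
    by (intro sum_mono) auto
  also have "\<dots> = c * real (card A) + (\<Sum>i\<in>A. max (g i - c) 0)"
    by (simp add: sum.distrib)
  also have "(\<Sum>i\<in>A. max (g i - c) 0) \<le> (\<Sum>i\<in>V. max (g i - c) 0)"
    using assms by (intro sum_mono2) auto
  finally show ?thesis by simp
qed

text \<open>The supporting line at \<open>x\<close> provides the threshold for
  \<open>sum_le_threshold\<close>; its slope is nonnegative, so \<open>card A\<close> may be
  replaced by the larger real \<open>x\<close>.\<close>

lemma sum_le_D:
  assumes "finite V" "\<And>i. i \<in> V \<Longrightarrow> 0 \<le> g i" "A \<subseteq> V" "real (card A) \<le> x"
  shows "(\<Sum>i\<in>A. real_of_int (g i)) \<le> D V g x"
proof -
  have "0 \<le> x" using assms(4) of_nat_0_le_iff order_trans by blast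
  with D_dual[of V g x] assms(1,2) obtain c where c: "c \<ge> 0" "D V g x = c * x + (\<Sum>i\<in>V. max (of_int (g i) - c) 0)"
    by auto
  have "(\<Sum>i\<in>A. real_of_int (g i)) \<le> c * real (card A) + (\<Sum>i\<in>V. max (of_int (g i) - c) 0)"
    by (rule sum_le_threshold[OF assms(1,3)])
  also have "\<dots> \<le> D V g x"
    unfolding c(2) using mult_left_mono[OF assms(4) c(1)] by simp
  finally show ?thesis .
qed

lemma D_nonneg:
  assumes "finite V" "\<And>i. i \<in> V \<Longrightarrow> 0 \<le> g i" "0 \<le> x"
  shows "0 \<le> D V g x"
  using sum_le_D[of V g "{}" x] assms by simp

subsection \<open>Degrees and switchings\<close>

lemma deg_S_eq_card: "deg_S G i = card {e \<in> G. fst e = i}"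
  unfolding deg_S_def by (rule bij_betw_same_card[of "\<lambda>v. (i, v)"]) (auto simp: bij_betw_def inj_on_def)

lemma deg_S_eq_sum: "finite G \<Longrightarrow> deg_S G i = (\<Sum>e\<in>G. of_bool (fst e = i))"
  by (simp add: deg_S_eq_card of_bool_def sum.If_cases Int_def)

text \<open>Transposing the graph exchanges the two parts; facts about T-degrees are obtained from
  those about S-degrees in this way.\<close>

lemma deg_T_eq_converse: "deg_T G i = deg_S (G\<inverse>) i"
  by (simp add: deg_S_def deg_T_def)

lemma deg_S_Un_disjoint: "finite G \<Longrightarrow> finite H \<Longrightarrow> G \<inter> H = {} \<Longrightarrow> deg_S (G \<union> H) i = deg_S G i + deg_S H i"
  by (metis deg_S_eq_sum finite_Un sum.union_disjoint)

lemma deg_T_Un_disjoint: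
  assumes "finite G" "finite H" "G \<inter> H = {}"
  shows "deg_T (G \<union> H) i = deg_T G i + deg_T H i"
  using deg_S_Un_disjoint[of "G\<inverse>" "H\<inverse>" i] assms by (simp add: deg_T_eq_converse converse_Un converse_Int[symmetric])

lemma deg_S_insert:
  assumes "finite H" "(u, v) \<notin> H"
  shows "deg_S (insert (u, v) H) i = deg_S H i + of_bool (i = u)"
  using assms by (auto simp: deg_S_eq_sum)

lemma deg_T_insert:
  assumes "finite H" "(u, v) \<notin> H"
  shows "deg_T (insert (u, v) H) i = deg_T H i + of_bool (i = v)"
proof -
  have "(insert (u, v) H)\<inverse> = insert (v, u) (H\<inverse>)" by auto
  then show ?thesis
    using deg_S_insert[of "H\<inverse>" v u i] assms by (simp add: deg_T_eq_converse)
qed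

lemma deg_S_mono: "finite G \<Longrightarrow> H \<subseteq> G \<Longrightarrow> deg_S H i \<le> deg_S G i"
  unfolding deg_S_eq_card by (intro card_mono) auto

lemma deg_S_Diff: "finite G \<Longrightarrow> H \<subseteq> G \<Longrightarrow> deg_S (G - H) i + deg_S H i = deg_S G i"
  using deg_S_Un_disjoint[of "G - H" H i] by (simp add: finite_subset Un_absorb2 Diff_disjoint Int_commute)

lemma deg_T_Diff: "finite G \<Longrightarrow> H \<subseteq> G \<Longrightarrow> deg_T (G - H) i + deg_T H i = deg_T G i"
  using deg_T_Un_disjoint[of "G - H" H i] by (simp add: finite_subset Un_absorb2 Diff_disjoint Int_commute)

lemma deg_S_switch:
  assumes "finite G" "finite A" "R \<subseteq> G" "A \<inter> G = {}" "deg_S R i = deg_S A i"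
  shows "deg_S ((G - R) \<union> A) i = deg_S G i"
proof -
  have "deg_S ((G - R) \<union> A) i = deg_S (G - R) i + deg_S A i"
    using assms by (intro deg_S_Un_disjoint) auto
  then show ?thesis
    using deg_S_Diff[of G R i] assms by simp
qed

lemma card_edges_into:
  assumes "finite E" "finite A"
  shows "card {e \<in> E. fst e \<in> A} = (\<Sum>x\<in>A. deg_S E x)"
proof -
  have "{e \<in> E. fst e \<in> A} = (\<Union>x\<in>A. {e \<in> E. fst e = x})" by auto
  also have "card \<dots> = (\<Sum>x\<in>A. deg_S E x)"
    unfolding deg_S_eq_card using assms by (intro card_UN_disjoint) auto
  finally show ?thesis .
qed

section \<open>The sets \<open>\<B>\<close> under switching\<close>

lemma finite_K: "finite (K m n)"
  by (simp add: K_def)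

lemma finite_\<B>: "finite (\<B> m n s t X Y)"
  by (rule finite_subset[of _ "Pow (K m n)"]) (auto simp: \<B>_def finite_K)

text \<open>Shared by both switchings: the removed edges \<open>R\<close> avoid the forced graph
  \<open>H\<close>, the added edges \<open>A\<close> avoid the forbidden graph \<open>L\<close>, and
  \<open>R\<close> and \<open>A\<close> have equal degrees everywhere.\<close>

lemma switch_in_\<B>:
  assumes "G \<in> \<B> m n s t H L" "R \<subseteq> G - H" "A \<inter> (G \<union> L) = {}" "A \<subseteq> K m n"
    and "\<And>i. deg_S R i = deg_S A i" "\<And>i. deg_T R i = deg_T A i"
  shows "(G - R) \<union> A \<in> \<B> m n s t H L"
proof -
  have G: "G \<subseteq> K m n" "finite G" "finite A"
    using assms(1,4) by (auto simp: \<B>_def intro: finite_subset[OF _ finite_K])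
  have "deg_S ((G - R) \<union> A) i = deg_S G i" for i
    using assms G by (intro deg_S_switch) auto
  moreover have "deg_T ((G - R) \<union> A) i = deg_T G i" for i
  proof -
    have "((G - R) \<union> A)\<inverse> = (G\<inverse> - R\<inverse>) \<union> A\<inverse>" by auto
    then show ?thesis
      unfolding deg_T_eq_converse using assms G
      by (simp only:) (intro deg_S_switch, auto simp: deg_T_eq_converse)
  qed
  ultimately show ?thesis
    using assms G by (auto simp: \<B>_def)
qed

text \<open>Deleting \<open>A\<close> and restoring \<open>R\<close> recovers the original graph, so
  a switching is invertible once its vertices are known.\<close>

lemma switch_inject:
  assumes "(G - R) \<union> A = (G' - R) \<union> A" "R \<subseteq> G" "R \<subseteq> G'" "A \<inter> G = {}" "A \<inter> G' = {}"
  shows "G = G'"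
  using assms by blast

section \<open>Counting edges and forbidden choices\<close>

lemma num_edges_card:
  assumes "G \<in> \<B> m n s t H L"
  shows "num_edges m s = card G"
proof -
  have G: "G \<subseteq> K m n" "\<And>u. u \<in> {1..m} \<Longrightarrow> deg_S G u = s u"
    using assms by (auto simp: \<B>_def)
  have "{e \<in> G. fst e \<in> {1..m}} = G" using G by (auto simp: K_def)
  then show ?thesis
    using card_edges_into[of G "{1..m}"] G finite_subset[OF G(1) finite_K]
    by (simp add: num_edges_def)
qed

text \<open>Applied with \<open>E\<close> the free edges \<open>G - H\<close> and
  \<open>F = G \<union> L\<close>: it bounds the edges xy whose switching would need an edge xv that
  is already present or forbidden. Grouping by x gives a sum of residual degrees over the neighbours
  of \<open>v\<close> in \<open>F\<close>.\<close>

lemma card_bad_S: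
  assumes "finite E" "finite V" "F \<subseteq> V \<times> W" "\<And>x. x \<in> V \<Longrightarrow> g x = int (deg_S E x)"
  shows "real (card {e \<in> E. (fst e, v) \<in> F}) \<le> D V g (real (deg_T F v))"
proof -
  let ?N = "{x. (x, v) \<in> F}"
  have N: "?N \<subseteq> V" "finite ?N" using assms finite_subset[of ?N V] by auto
  have "real (card {e \<in> E. (fst e, v) \<in> F}) = (\<Sum>x\<in>?N. real (deg_S E x))"
    using card_edges_into[OF assms(1) N(2)] by simp
  also have "\<dots> = (\<Sum>x\<in>?N. of_int (g x))"
    using N assms(4) by (intro sum.cong) auto
  also have "\<dots> \<le> D V g (real (deg_T F v))"
    using N assms by (intro sum_le_D) (auto simp: deg_T_def)
  finally show ?thesis .
qed

lemma card_bad_T: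
  assumes "finite E" "finite W" "F \<subseteq> V \<times> W" "\<And>y. y \<in> W \<Longrightarrow> g y = int (deg_T E y)"
  shows "real (card {e \<in> E. (u, snd e) \<in> F}) \<le> D W g (real (deg_S F u))"
proof -
  have "{e \<in> E\<inverse>. (fst e, u) \<in> F\<inverse>} = prod.swap ` {e \<in> E. (u, snd e) \<in> F}"
    by (auto simp: image_iff)
  then have "card {e \<in> E\<inverse>. (fst e, u) \<in> F\<inverse>} = card {e \<in> E. (u, snd e) \<in> F}"
    by (simp add: card_image)
  moreover have "real (card {e \<in> E\<inverse>. (fst e, u) \<in> F\<inverse>}) \<le> D W g (real (deg_T (F\<inverse>) u))"
    using assms by (intro card_bad_S[of _ _ _ V]) (auto simp: deg_T_eq_converse)
  ultimately show ?thesis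
    by (simp add: deg_T_eq_converse)
qed

text \<open>One supporting line of the concave function \<open>D V g\<close>, taken at the average, bounds the
  number of bad edges for all neighbours of \<open>u\<close> at once; this plays the role of Jensen's inequality.\<close>

lemma card_bad_triples_S:
  assumes fin: "finite E" "finite V" "finite W" and "E \<subseteq> V \<times> W" "F \<subseteq> V \<times> W"
    and g: "\<And>x. x \<in> V \<Longrightarrow> g x = int (deg_S E x)"
    and b: "\<And>y. y \<in> W \<Longrightarrow> int (deg_T F y) \<le> b y"
    and N: "N = real (deg_S E u)" "N > 0"
  shows "real (card {(y, e). (u, y) \<in> E \<and> e \<in> E \<and> (fst e, y) \<in> F}) \<le> N * D V g (D W b N / N)"
proof -
  let ?Y = "{y. (u, y) \<in> E}"
  let ?X = "\<lambda>y. {x. (x, y) \<in> F}"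
  have Y: "?Y \<subseteq> W" "finite ?Y" using assms finite_subset[of ?Y W] by auto
  have X: "?X y \<subseteq> V" "finite (?X y)" for y using assms finite_subset[of "?X y" V] by auto
  have b0: "b y \<ge> 0" if "y \<in> W" for y using b[OF that] by linarith
  have N': "real (card ?Y) = N" using N by (simp add: deg_S_def)
  \<comment> \<open>Divided by \<open>N\<close>, this says that the average of \<open>b\<close> over
    the neighbours of \<open>u\<close> is at most the argument of \<open>D V g\<close> in the
    conclusion, which becomes \<alpha>_u.\<close>
  have bN: "(\<Sum>y\<in>?Y. real_of_int (b y)) \<le> D W b N"
    using Y b0 fin N' by (intro sum_le_D) auto
  have "D W b N \<ge> 0" using D_nonneg[of W b N] fin b0 N by simp
  \<comment> \<open>This line touches \<open>D V g\<close> at that argument, and its slope serves as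
    common threshold for all neighbours y of \<open>u\<close>.\<close>
  then obtain c where c: "c \<ge> 0" "D V g (D W b N / N) = c * (D W b N / N) + (\<Sum>i\<in>V. max (of_int (g i) - c) 0)"
    using D_dual[of V g "D W b N / N"] fin g N by auto
  let ?M = "\<Sum>i\<in>V. max (of_int (g i) - c) 0"
  have "{(y, e). (u, y) \<in> E \<and> e \<in> E \<and> (fst e, y) \<in> F} = (SIGMA y:?Y. {e \<in> E. fst e \<in> ?X y})"
    by auto
  then have "real (card {(y, e). (u, y) \<in> E \<and> e \<in> E \<and> (fst e, y) \<in> F})
      = (\<Sum>y\<in>?Y. real (card {e \<in> E. fst e \<in> ?X y}))"
    using Y fin by simp
  also have "\<dots> = (\<Sum>y\<in>?Y. \<Sum>x\<in>?X y. real (deg_S E x))"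
    using card_edges_into[OF fin(1) X(2)] by simp
  also have "\<dots> = (\<Sum>y\<in>?Y. \<Sum>x\<in>?X y. of_int (g x))"
  proof (intro sum.cong refl)
    fix x y assume "x \<in> ?X y"
    then have "x \<in> V" using X(1) by blast
    then show "real (deg_S E x) = of_int (g x)" using g by simp
  qed
  also have "\<dots> \<le> (\<Sum>y\<in>?Y. c * real (card (?X y)) + ?M)"
    using fin X by (intro sum_mono sum_le_threshold) auto
  also have "\<dots> \<le> (\<Sum>y\<in>?Y. c * of_int (b y) + ?M)"
  proof (intro sum_mono add_mono mult_left_mono order_refl c(1))
    fix y assume "y \<in> ?Y"
    then have "int (deg_T F y) \<le> b y" using Y b by auto
    then show "real (card (?X y)) \<le> of_int (b y)" unfolding deg_T_def by linarith
  qed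
  also have "\<dots> = c * (\<Sum>y\<in>?Y. of_int (b y)) + N * ?M"
    by (simp add: sum.distrib sum_distrib_left N')
  also have "\<dots> \<le> c * D W b N + N * ?M"
    using mult_left_mono[OF bN c(1)] by simp
  also have "\<dots> = N * D V g (D W b N / N)"
    unfolding c(2) using N(2) by (simp add: field_simps)
  finally show ?thesis .
qed

text \<open>The previous count for the transposed graphs; \<open>prod.swap\<close> acts only on the
  edge component of a pair.\<close>

lemma card_bad_triples_T:
  assumes fin: "finite E" "finite V" "finite W" and "E \<subseteq> V \<times> W" "F \<subseteq> V \<times> W"
    and g: "\<And>y. y \<in> W \<Longrightarrow> g y = int (deg_T E y)"
    and b: "\<And>x. x \<in> V \<Longrightarrow> int (deg_S F x) \<le> b x"
    and N: "N = real (deg_T E v)" "N > 0"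
  shows "real (card {(w, e). (w, v) \<in> E \<and> e \<in> E \<and> (w, snd e) \<in> F}) \<le> N * D W g (D V b N / N)"
proof -
  let ?B = "{(w, e). (w, v) \<in> E \<and> e \<in> E \<and> (w, snd e) \<in> F}"
  let ?B' = "{(w, e). (v, w) \<in> E\<inverse> \<and> e \<in> E\<inverse> \<and> (fst e, w) \<in> F\<inverse>}"
  have "?B' = map_prod id prod.swap ` ?B"
    by (auto simp: image_iff)
  moreover have "inj_on (map_prod id prod.swap) ?B"
    by (auto intro!: inj_onI)
  ultimately have "card ?B' = card ?B"
    using card_image by fastforce
  moreover have "real (card ?B') \<le> N * D W g (D V b N / N)"
  proof (rule card_bad_triples_S)
    show "finite (E\<inverse>)" "finite W" "finite V" "E\<inverse> \<subseteq> W \<times> V" "F\<inverse> \<subseteq> W \<times> V"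
      using assms(1-5) by auto
    show "g y = int (deg_S (E\<inverse>) y)" if "y \<in> W" for y
      using g[OF that] by (simp add: deg_T_eq_converse)
    show "int (deg_T (F\<inverse>) x) \<le> b x" if "x \<in> V" for x
      using b[OF that] by (simp add: deg_T_eq_converse)
    show "N = real (deg_S (E\<inverse>) v)" "N > 0"
      using N by (simp_all add: deg_T_eq_converse)
  qed
  ultimately show ?thesis by simp
qed

text \<open>Double counting of switchings: every \<open>x\<close> offers at least \<open>c\<close>
  moves, every \<open>y\<close> is reached by at most \<open>d\<close>, and \<open>f\<close> records
  a move together with the data needed to undo it.\<close>

lemma real_sum_card_le:
  assumes "finite A" "finite B" "\<And>x. x \<in> A \<Longrightarrow> finite (P x)" "\<And>y. y \<in> B \<Longrightarrow> finite (Q y)"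
    and "inj_on f (Sigma A P)" "f ` Sigma A P \<subseteq> Sigma B Q"
    and "\<And>x. x \<in> A \<Longrightarrow> c \<le> real (card (P x))" "\<And>y. y \<in> B \<Longrightarrow> real (card (Q y)) \<le> d"
  shows "real (card A) * c \<le> real (card B) * d"
proof -
  have "real (card A) * c \<le> (\<Sum>x\<in>A. real (card (P x)))"
    using assms(7) by (intro sum_bounded_below) auto
  also have "\<dots> = real (card (Sigma A P))"
    using assms by simp
  also have "\<dots> \<le> real (card (Sigma B Q))"
    using assms by (intro of_nat_mono card_inj_on_le[of f]) auto
  also have "\<dots> = (\<Sum>y\<in>B. real (card (Q y)))"
    using assms by simp
  also have "\<dots> \<le> real (card B) * d"
    using assms(8) by (intro sum_bounded_above) auto
  finally show ?thesis .
qed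

section \<open>Residual degrees and switchings along a 4-cycle\<close>

lemma residual_degrees:
  assumes "G \<in> \<B> m n s t H L" "L \<subseteq> K m n"
  shows "finite G" "H \<subseteq> G"
    and "u \<in> {1..m} \<Longrightarrow> int (s u) - int (deg_S H u) = int (deg_S (G - H) u)"
    and "v \<in> {1..n} \<Longrightarrow> int (t v) - int (deg_T H v) = int (deg_T (G - H) v)"
    and "u \<in> {1..m} \<Longrightarrow> deg_S (G \<union> L) u = s u + deg_S L u"
    and "v \<in> {1..n} \<Longrightarrow> deg_T (G \<union> L) v = t v + deg_T L v"
    and "real (card (G - H)) = real (num_edges m s) - real (card H)"
proof -
  have G: "G \<subseteq> K m n" "H \<subseteq> G" "G \<inter> L = {}" using assms by (auto simp: \<B>_def)
  then have fin: "finite G" "finite L" using assms finite_subset[OF _ finite_K] by auto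
  show "finite G" "H \<subseteq> G" using fin G by auto
  show "u \<in> {1..m} \<Longrightarrow> int (s u) - int (deg_S H u) = int (deg_S (G - H) u)"
    using deg_S_Diff[OF fin(1) G(2), of u] assms by (auto simp: \<B>_def)
  show "v \<in> {1..n} \<Longrightarrow> int (t v) - int (deg_T H v) = int (deg_T (G - H) v)"
    using deg_T_Diff[OF fin(1) G(2), of v] assms by (auto simp: \<B>_def)
  show "u \<in> {1..m} \<Longrightarrow> deg_S (G \<union> L) u = s u + deg_S L u"
    using deg_S_Un_disjoint[OF fin G(3), of u] assms by (auto simp: \<B>_def)
  show "v \<in> {1..n} \<Longrightarrow> deg_T (G \<union> L) v = t v + deg_T L v"
    using deg_T_Un_disjoint[OF fin G(3), of v] assms by (auto simp: \<B>_def)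
  show "real (card (G - H)) = real (num_edges m s) - real (card H)"
    using num_edges_card[OF assms(1)] fin G
    by (simp add: card_Diff_subset finite_subset card_mono of_nat_diff)
qed

text \<open>Forward, a free edge xy is chosen with uy and xv outside \<open>G \<union> L\<close>;
  the bad choices are bounded by \<open>T_sum\<close> and \<open>S_sum\<close>. Backward, y and x
  are residual neighbours of \<open>u\<close> and \<open>v\<close>, which gives the product of
  residual degrees.\<close>

lemma two_switch_count:
  assumes "L \<subseteq> K m n" "(u, v) \<in> K m n" "(u, v) \<notin> H"
  shows "real (card {G \<in> \<B> m n s t H L. (u, v) \<in> G}) *
      (real (num_edges m s) - real (card H)
        - (T_sum n t H (real (s u) + real (deg_S L u)) + S_sum m s H (real (t v) + real (deg_T L v))))
    \<le> real (card {G \<in> \<B> m n s t H L. (u, v) \<notin> G}) *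
      ((real (s u) - real (deg_S H u)) * (real (t v) - real (deg_T H v)))"
proof (rule real_sum_card_le)
  let ?P = "\<lambda>G. {e \<in> G - H. (u, snd e) \<notin> G \<union> L \<and> (fst e, v) \<notin> G \<union> L}"
  let ?Q = "\<lambda>G. {y. (u, y) \<in> G - H} \<times> {x. (x, v) \<in> G - H}"
  let ?f = "\<lambda>(G, x, y). ((G - {(u, v), (x, y)}) \<union> {(u, y), (x, v)}, y, x)"
  let ?B1 = "{G \<in> \<B> m n s t H L. (u, v) \<in> G}"
  let ?B0 = "{G \<in> \<B> m n s t H L. (u, v) \<notin> G}"
  have uv: "u \<in> {1..m}" "v \<in> {1..n}" using assms by (auto simp: K_def)
  show "finite ?B1" "finite ?B0"
    using finite_\<B> by auto
  show "finite (?P G)" if "G \<in> ?B1" for G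
    using that residual_degrees(1)[OF _ assms(1)] by auto
  have sub: "{y. (u, y) \<in> G - H} \<subseteq> {1..n}" "{x. (x, v) \<in> G - H} \<subseteq> {1..m}"
    if "G \<in> \<B> m n s t H L" for G
    using that by (auto simp: \<B>_def K_def)
  show "finite (?Q G)" if "G \<in> ?B0" for G
    using that sub[of G] by (auto intro!: finite_cartesian_product intro: finite_subset)
  show "real (card (?Q G)) \<le> (real (s u) - real (deg_S H u)) * (real (t v) - real (deg_T H v))"
    if "G \<in> ?B0" for G
  proof -
    have G: "G \<in> \<B> m n s t H L" using that by simp
    note r = residual_degrees[OF G assms(1)]
    have "real (s u) - real (deg_S H u) = real (card {y. (u, y) \<in> G - H})"
      using r(3)[OF uv(1)] unfolding deg_S_def[of "G - H"] by linarith
    moreover have "real (t v) - real (deg_T H v) = real (card {x. (x, v) \<in> G - H})"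
      using r(4)[OF uv(2)] unfolding deg_T_def[of "G - H"] by linarith
    ultimately show ?thesis
      by (simp add: card_cartesian_product)
  qed
  show "real (num_edges m s) - real (card H)
        - (T_sum n t H (real (s u) + real (deg_S L u)) + S_sum m s H (real (t v) + real (deg_T L v)))
      \<le> real (card (?P G))" if "G \<in> ?B1" for G
  proof -
    have G: "G \<in> \<B> m n s t H L" using that by simp
    then have GK: "G \<union> L \<subseteq> {1..m} \<times> {1..n}"
      using assms(1) unfolding \<B>_def K_def by blast
    note r = residual_degrees[OF G assms(1)]
    then have fin: "finite (G - H)" by simp
    let ?A = "{e \<in> G - H. (u, snd e) \<in> G \<union> L}"
    let ?B = "{e \<in> G - H. (fst e, v) \<in> G \<union> L}"
    have "real (card ?A) \<le> T_sum n t H (real (s u) + real (deg_S L u))"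
      using card_bad_T[OF fin _ GK, of "\<lambda>v. int (t v) - int (deg_T H v)" u] r uv
      by (simp add: T_sum_def)
    moreover have "real (card ?B) \<le> S_sum m s H (real (t v) + real (deg_T L v))"
      using card_bad_S[OF fin _ GK, of "\<lambda>u. int (s u) - int (deg_S H u)" v] r uv
      by (simp add: S_sum_def)
    moreover have "card (G - H) \<le> card (?P G) + (card ?A + card ?B)"
    proof -
      have "card (G - H) \<le> card (?P G \<union> (?A \<union> ?B))"
        by (intro card_mono finite_subset[OF _ fin]) auto
      also have "\<dots> \<le> card (?P G) + card (?A \<union> ?B)" by (rule card_Un_le)
      also have "card (?A \<union> ?B) \<le> card ?A + card ?B" by (rule card_Un_le)
      finally show ?thesis by simp
    qed
    ultimately show ?thesis
      using r(7) by linarith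
  qed
  show "inj_on ?f (Sigma ?B1 ?P)"
  proof (rule inj_onI)
    fix z z' assume z: "z \<in> Sigma ?B1 ?P" "z' \<in> Sigma ?B1 ?P" "?f z = ?f z'"
    obtain G x y G' x' y' where zz: "z = (G, x, y)" "z' = (G', x', y')"
      by (metis surj_pair)
    then have "x' = x" "y' = y" using z(3) by auto
    moreover from this have "G = G'"
      using z unfolding zz
      by (intro switch_inject[of G "{(u, v), (x, y)}" "{(u, y), (x, v)}" G']) auto
    ultimately show "z = z'" using zz by simp
  qed
  show "?f ` Sigma ?B1 ?P \<subseteq> Sigma ?B0 ?Q"
  proof
    fix g assume "g \<in> ?f ` Sigma ?B1 ?P"
    then obtain a where "a \<in> Sigma ?B1 ?P" "g = ?f a" by (rule imageE)
    moreover obtain G x y where "a = (G, x, y)" by (metis surj_pair)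
    ultimately have mem: "(G, x, y) \<in> Sigma ?B1 ?P" and g: "g = ?f (G, x, y)" by simp_all
    from mem have *: "G \<in> \<B> m n s t H L" "(u, v) \<in> G" "(x, y) \<in> G" "(x, y) \<notin> H"
      and **: "(u, y) \<notin> G" "(x, v) \<notin> G" "(u, y) \<notin> L" "(x, v) \<notin> L" by auto
    \<comment> \<open>Degenerate choices are already excluded: x = u would put uy into
      \<open>G\<close>, and y = v would put xv into \<open>G\<close>.\<close>
    then have ne: "x \<noteq> u" "y \<noteq> v" using * by auto
    have sub: "H \<subseteq> G" "(x, y) \<in> K m n" using * by (auto simp: \<B>_def)
    have "(G - {(u, v), (x, y)}) \<union> {(u, y), (x, v)} \<in> \<B> m n s t H L"
    proof (rule switch_in_\<B>)
      show "{(u, y), (x, v)} \<subseteq> K m n" using sub assms by (auto simp: K_def)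
      show "deg_S {(u, v), (x, y)} i = deg_S {(u, y), (x, v)} i" for i
        using ne by (simp add: deg_S_insert deg_S_def[of "{}"])
      show "deg_T {(u, v), (x, y)} i = deg_T {(u, y), (x, v)} i" for i
        using ne by (simp add: deg_T_insert deg_T_def[of "{}"])
    qed (use * ** assms in auto)
    then show "g \<in> Sigma ?B0 ?Q"
      unfolding g using ne sub ** by auto
  qed
qed


section \<open>Switchings along a hexagon\<close>

lemma card_Diff_Un_ge:
  assumes "finite A" "finite B" "finite C"
  shows "real (card A) - (real (card B) + real (card C)) \<le> real (card (A - (B \<union> C)))"
proof -
  have "card A \<le> card ((A - (B \<union> C)) \<union> (B \<union> C))"
    using assms by (intro card_mono) auto
  also have "\<dots> \<le> card (A - (B \<union> C)) + card (B \<union> C)" by (rule card_Un_le)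
  also have "card (B \<union> C) \<le> card B + card C" by (rule card_Un_le)
  finally show ?thesis by simp
qed

text \<open>There are \<open>?a * ?b * ?k\<close> triples of a residual neighbour y of
  \<open>u\<close>, a residual neighbour w of \<open>v\<close> and a free edge xz. Those with xy in
  \<open>G \<union> L\<close> and those with wz in \<open>G \<union> L\<close> are
  subtracted.\<close>

lemma three_switch_choices:
  assumes "L \<subseteq> K m n" "(u, v) \<in> K m n" and G: "G \<in> \<B> m n s t H L"
  shows "(real (s u) - real (deg_S H u)) * (real (t v) - real (deg_T H v))
      * (real (num_edges m s) - real (card H)
        - (S_sum m s H (alpha {1..n} t (deg_T L) s (deg_S H) u)
           + T_sum n t H (alpha {1..m} s (deg_S L) t (deg_T H) v)))
    \<le> real (card {(y, w, e). (u, y) \<in> G - H \<and> (w, v) \<in> G - H \<and> e \<in> G - H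
        \<and> (fst e, y) \<notin> G \<union> L \<and> (w, snd e) \<notin> G \<union> L})"
    (is "?a * ?b * (?k - (?\<sigma> + ?\<tau>)) \<le> real (card ?P)")
proof (cases "?a = 0 \<or> ?b = 0")
  case True
  then show ?thesis by auto
next
  case False
  let ?E = "G - H"
  let ?F = "G \<union> L"
  let ?Y = "{y. (u, y) \<in> ?E}"
  let ?W = "{w. (w, v) \<in> ?E}"
  note r = residual_degrees[OF G assms(1)]
  have uv: "u \<in> {1..m}" "v \<in> {1..n}" using assms by (auto simp: K_def)
  have EK: "?E \<subseteq> {1..m} \<times> {1..n}" and FK: "?F \<subseteq> {1..m} \<times> {1..n}"
    using assms unfolding \<B>_def K_def by blast+
  have fin: "finite ?E" using r by simp
  have a: "?a = real (deg_S ?E u)" and b: "?b = real (deg_T ?E v)"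
    using r(3)[OF uv(1)] r(4)[OF uv(2)] by linarith+
  \<comment> \<open>Residual degrees are natural numbers, so nonzero means at least 1, and the
    maximum in \<open>alpha\<close> is attained by the residual degree.\<close>
  then have a1: "?a \<ge> 1" and b1: "?b \<ge> 1" using False by auto
  have YW: "finite ?Y" "finite ?W"
    using EK finite_subset[of ?Y "{1..n}"] finite_subset[of ?W "{1..m}"] by auto
  let ?A1 = "{(y, e). (u, y) \<in> ?E \<and> e \<in> ?E \<and> (fst e, y) \<in> ?F}"
  let ?A2 = "{(w, e). (w, v) \<in> ?E \<and> e \<in> ?E \<and> (w, snd e) \<in> ?F}"
  have A1: "real (card ?A1) \<le> ?a * ?\<sigma>"
    unfolding S_sum_def alpha_def max_absorb1[OF a1]
    by (rule card_bad_triples_S[OF fin _ _ EK FK]) (use r a a1 uv in auto)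
  have A2: "real (card ?A2) \<le> ?b * ?\<tau>"
    unfolding T_sum_def alpha_def max_absorb1[OF b1]
    by (rule card_bad_triples_T[OF fin _ _ EK FK]) (use r b b1 uv in auto)
  let ?T = "?Y \<times> ?W \<times> ?E"
  \<comment> \<open>Being bad for xy does not depend on w, so w is free; the map only reorders
    coordinates to make both bad sets subsets of \<open>?T\<close>.\<close>
  let ?B1 = "(\<lambda>(w, y, e). (y, w, e)) ` (?W \<times> ?A1)"
  let ?B2 = "?Y \<times> ?A2"
  have fA: "finite ?A1" "finite ?A2"
    by (rule finite_subset[of _ "?Y \<times> ?E"] finite_subset[of _ "?W \<times> ?E"]; use YW fin in auto)+
  have cT: "real (card ?T) = ?a * ?b * ?k"
    using r(7) unfolding a b by (simp add: card_cartesian_product deg_S_def deg_T_def)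
  have "card ?B1 = card (?W \<times> ?A1)"
    by (rule card_image) (auto simp: inj_on_def)
  also have "real \<dots> = ?b * real (card ?A1)"
    unfolding b deg_T_def[of ?E] by (simp only: card_cartesian_product of_nat_mult)
  also have "\<dots> \<le> ?b * (?a * ?\<sigma>)"
    using mult_left_mono[OF A1, of ?b] b1 by linarith
  finally have B1: "real (card ?B1) \<le> ?b * (?a * ?\<sigma>)" .
  have "real (card ?B2) = ?a * real (card ?A2)"
    unfolding a deg_S_def[of ?E] by (simp only: card_cartesian_product of_nat_mult)
  also have "\<dots> \<le> ?a * (?b * ?\<tau>)"
    using mult_left_mono[OF A2, of ?a] a1 by linarith
  finally have B2: "real (card ?B2) \<le> ?a * (?b * ?\<tau>)" .
  have "?P = ?T - (?B1 \<union> ?B2)"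
    by (auto simp: image_iff)
  then have "real (card ?T) - (real (card ?B1) + real (card ?B2)) \<le> real (card ?P)"
    using card_Diff_Un_ge[of ?T ?B1 ?B2] YW fin fA by simp
  moreover have "?a * ?b * (?k - (?\<sigma> + ?\<tau>)) = ?a * ?b * ?k - (?b * (?a * ?\<sigma>) + ?a * (?b * ?\<tau>))"
    by (simp add: algebra_simps)
  ultimately show ?thesis
    using cT B1 B2 by linarith
qed

text \<open>Backward, the edges xy and wz determine the switching. They are not in \<open>H\<close>,
  because they were absent from the original graph, so they form one of at most (m(G) - m(H))^2
  pairs of free edges.\<close>

lemma three_switch_count:
  assumes "L \<subseteq> K m n" "(u, v) \<in> K m n" "(u, v) \<notin> H" "(u, v) \<notin> L"
  shows "real (card {G \<in> \<B> m n s t H L. (u, v) \<notin> G}) *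
      ((real (s u) - real (deg_S H u)) * (real (t v) - real (deg_T H v))
      * (real (num_edges m s) - real (card H)
        - (S_sum m s H (alpha {1..n} t (deg_T L) s (deg_S H) u)
           + T_sum n t H (alpha {1..m} s (deg_S L) t (deg_T H) v))))
    \<le> real (card {G \<in> \<B> m n s t H L. (u, v) \<in> G}) * (real (num_edges m s) - real (card H))\<^sup>2"
proof (rule real_sum_card_le)
  let ?P = "\<lambda>G. {(y, w, e). (u, y) \<in> G - H \<and> (w, v) \<in> G - H \<and> e \<in> G - H
        \<and> (fst e, y) \<notin> G \<union> L \<and> (w, snd e) \<notin> G \<union> L}"
  let ?Q = "\<lambda>G. (G - H) \<times> (G - H)"
  let ?f = "\<lambda>(G, y, w, x, z). ((G - {(u, y), (x, z), (w, v)}) \<union> {(u, v), (x, y), (w, z)}, (x, y), (w, z))"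
  let ?B1 = "{G \<in> \<B> m n s t H L. (u, v) \<in> G}"
  let ?B0 = "{G \<in> \<B> m n s t H L. (u, v) \<notin> G}"
  show "finite ?B1" "finite ?B0"
    using finite_\<B> by auto
  have fin: "finite (G - H)" "G \<subseteq> {1..m} \<times> {1..n}" if "G \<in> \<B> m n s t H L" for G
    using residual_degrees(1)[OF that assms(1)] that by (auto simp: \<B>_def K_def)
  show "finite (?P G)" if "G \<in> ?B0" for G
    by (rule finite_subset[of _ "{1..n} \<times> {1..m} \<times> (G - H)"]) (use that fin[of G] in auto)
  show "finite (?Q G)" if "G \<in> ?B1" for G
    using that fin(1)[of G] by simp
  show "real (card (?Q G)) \<le> (real (num_edges m s) - real (card H))\<^sup>2" if "G \<in> ?B1" for G
    using that residual_degrees(7)[of G m n s t H L] assms(1)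
    by (simp add: card_cartesian_product power2_eq_square)
  show "(real (s u) - real (deg_S H u)) * (real (t v) - real (deg_T H v))
      * (real (num_edges m s) - real (card H)
        - (S_sum m s H (alpha {1..n} t (deg_T L) s (deg_S H) u)
           + T_sum n t H (alpha {1..m} s (deg_S L) t (deg_T H) v)))
      \<le> real (card (?P G))" if "G \<in> ?B0" for G
    using three_switch_choices[OF assms(1,2), of G s t H] that by simp
  show "inj_on ?f (Sigma ?B0 ?P)"
  proof (rule inj_onI)
    fix a a' assume a: "a \<in> Sigma ?B0 ?P" "a' \<in> Sigma ?B0 ?P" "?f a = ?f a'"
    obtain G y w x z G' y' w' x' z' where aa: "a = (G, y, w, x, z)" "a' = (G', y', w', x', z')"
      by (metis surj_pair)
    then have "y' = y" "w' = w" "x' = x" "z' = z" using a(3) by auto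
    moreover from this have "G = G'"
      using a unfolding aa
      by (intro switch_inject[of G "{(u, y), (x, z), (w, v)}" "{(u, v), (x, y), (w, z)}" G']) auto
    ultimately show "a = a'" using aa by simp
  qed
  show "?f ` Sigma ?B0 ?P \<subseteq> Sigma ?B1 ?Q"
  proof
    fix g assume "g \<in> ?f ` Sigma ?B0 ?P"
    then obtain a where "a \<in> Sigma ?B0 ?P" "g = ?f a" by (rule imageE)
    moreover obtain G y w x z where "a = (G, y, w, x, z)" by (metis surj_pair)
    ultimately have mem: "(G, y, w, x, z) \<in> Sigma ?B0 ?P" and g: "g = ?f (G, y, w, x, z)" by simp_all
    from mem have *: "G \<in> \<B> m n s t H L" "(u, v) \<notin> G" "(u, y) \<in> G" "(u, y) \<notin> H" "(w, v) \<in> G" "(w, v) \<notin> H"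
      "(x, z) \<in> G" "(x, z) \<notin> H"
      and **: "(x, y) \<notin> G" "(w, z) \<notin> G" "(x, y) \<notin> L" "(w, z) \<notin> L" by auto
    \<comment> \<open>Any coincidence would identify a present edge with an absent one; for instance
      x = w would identify xz with wz.\<close>
    then have ne: "x \<noteq> u" "x \<noteq> w" "z \<noteq> v" "z \<noteq> y" "u \<noteq> w" "y \<noteq> v" using * by auto
    have sub: "H \<subseteq> G" "{(u, y), (x, z), (w, v)} \<subseteq> K m n" using * by (auto simp: \<B>_def)
    have "(G - {(u, y), (x, z), (w, v)}) \<union> {(u, v), (x, y), (w, z)} \<in> \<B> m n s t H L"
    proof (rule switch_in_\<B>)
      show "{(u, v), (x, y), (w, z)} \<subseteq> K m n" using sub by (auto simp: K_def)
      show "deg_S {(u, y), (x, z), (w, v)} i = deg_S {(u, v), (x, y), (w, z)} i" for i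
        using ne by (simp add: deg_S_insert deg_S_def[of "{}"])
      show "deg_T {(u, y), (x, z), (w, v)} i = deg_T {(u, v), (x, y), (w, z)} i" for i
        using ne by (simp add: deg_T_insert deg_T_def[of "{}"])
    qed (use * ** assms in auto)
    then show "g \<in> Sigma ?B1 ?Q"
      unfolding g using ne sub ** * by auto
  qed
qed

subsection \<open>One edge\<close>

text \<open>Forcing one more edge is the same as conditioning on it; this turns the switching counts
  into ratios of consecutive sizes of \<open>\<B>\<close>.\<close>

lemma \<B>_insert: "\<B> m n s t (insert e H) L = {G \<in> \<B> m n s t H L. e \<in> G}"
  by (auto simp: \<B>_def)

lemma card_\<B>_split:
  "real (card {G \<in> \<B> m n s t H L. e \<notin> G})
    = real (card (\<B> m n s t H L)) - real (card (\<B> m n s t (insert e H) L))"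
proof -
  have "card (\<B> m n s t H L) = card ({G \<in> \<B> m n s t H L. e \<in> G} \<union> {G \<in> \<B> m n s t H L. e \<notin> G})"
    by (rule arg_cong[of _ _ card]) auto
  also have "\<dots> = card {G \<in> \<B> m n s t H L. e \<in> G} + card {G \<in> \<B> m n s t H L. e \<notin> G}"
    using finite_\<B> by (intro card_Un_disjoint) auto
  finally show ?thesis by (simp add: \<B>_insert)
qed

lemma card_less_num_edges:
  assumes "G \<in> \<B> m n s t (insert e H) L" "e \<notin> H"
  shows "card H < num_edges m s"
proof -
  have "finite G" "insert e H \<subseteq> G"
    using assms(1) finite_subset[OF _ finite_K] by (auto simp: \<B>_def)
  then have "card H < card G" using assms(2) by (intro psubset_card_mono) auto
  then show ?thesis using num_edges_card[OF assms(1)] by simp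
qed

text \<open>The 4-cycle count solved for the graphs containing uv. A graph containing uv ensures
  that the denominator is positive and the residual degrees nonnegative.\<close>

lemma edge_upper_bound:
  assumes "L \<subseteq> K m n" "(u, v) \<in> K m n" "(u, v) \<notin> H" "\<B> m n s t (insert (u, v) H) L \<noteq> {}"
    and "p m n s t H L (u, v) > 0"
  shows "real (card (\<B> m n s t (insert (u, v) H) L))
    \<le> real (card (\<B> m n s t H L)) * ((real (s u) - real (deg_S H u)) * (real (t v) - real (deg_T H v)))
      / ((real (num_edges m s) - real (card H)) * p m n s t H L (u, v))"
proof -
  let ?k = "real (num_edges m s) - real (card H)"
  let ?ab = "(real (s u) - real (deg_S H u)) * (real (t v) - real (deg_T H v))"
  obtain G where G: "G \<in> \<B> m n s t (insert (u, v) H) L" using assms(4) by auto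
  then have G': "G \<in> \<B> m n s t H L" by (simp add: \<B>_insert)
  have k: "?k > 0" using card_less_num_edges[OF G assms(3)] by simp
  have "?ab \<ge> 0"
    using residual_degrees(3,4)[OF G' assms(1)] assms(2) by (intro mult_nonneg_nonneg) (force simp: K_def)+
  have "real (card (\<B> m n s t (insert (u, v) H) L)) * (?k * p m n s t H L (u, v))
    = real (card {G \<in> \<B> m n s t H L. (u, v) \<in> G}) *
      (?k - (T_sum n t H (real (s u) + real (deg_S L u)) + S_sum m s H (real (t v) + real (deg_T L v))))"
    using k by (simp add: \<B>_insert field_simps)
  also have "\<dots> \<le> real (card {G \<in> \<B> m n s t H L. (u, v) \<notin> G}) * ?ab"
    by (rule two_switch_count[OF assms(1-3)])
  \<comment> \<open>The graphs avoiding uv are crudely replaced by all graphs of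
    \<open>\<B> m n s t H L\<close>.\<close>
  also have "\<dots> \<le> real (card (\<B> m n s t H L)) * ?ab"
    using \<open>?ab \<ge> 0\<close> finite_\<B> by (intro mult_right_mono of_nat_mono card_mono) auto
  finally show ?thesis
    using mult_pos_pos[OF k assms(5)] by (simp only: pos_le_divide_eq)
qed

lemma alpha_nonneg:
  assumes "finite V"
  shows "alpha V a l g h w \<ge> 0"
  unfolding alpha_def using assms by (intro divide_nonneg_nonneg D_nonneg) auto

lemma S_sum_nonneg:
  assumes "G \<in> \<B> m n s t H L" "L \<subseteq> K m n" "x \<ge> 0"
  shows "S_sum m s H x \<ge> 0"
  unfolding S_sum_def using residual_degrees(3)[OF assms(1,2)] assms(3) by (intro D_nonneg) auto

lemma T_sum_nonneg:
  assumes "G \<in> \<B> m n s t H L" "L \<subseteq> K m n" "x \<ge> 0"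
  shows "T_sum n t H x \<ge> 0"
  unfolding T_sum_def using residual_degrees(4)[OF assms(1,2)] assms(3) by (intro D_nonneg) auto

text \<open>With N graphs in all, N1 of them containing uv, and Q the value of \<open>q\<close>, the
  hexagon count reads (N - N1) r Q \<le> N1. Solving for N1 gives the proportion r Q / (1 + r Q),
  which is then weakened.\<close>

lemma edge_lower_bound:
  assumes L: "L \<subseteq> K m n" and "(u, v) \<in> K m n" "(u, v) \<notin> H" "(u, v) \<notin> L" "\<B> m n s t H L \<noteq> {}"
    and "card H < num_edges m s" "deg_S H u \<le> s u" "deg_T H v \<le> t v"
  defines "r \<equiv> (real (s u) - real (deg_S H u)) * (real (t v) - real (deg_T H v))
      / (real (num_edges m s) - real (card H))"
  shows "real (card (\<B> m n s t H L)) * (r * q m n s t H L (u, v) / (1 + r))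
    \<le> real (card (\<B> m n s t (insert (u, v) H) L))"
proof -
  let ?k = "real (num_edges m s) - real (card H)"
  let ?ab = "(real (s u) - real (deg_S H u)) * (real (t v) - real (deg_T H v))"
  let ?st = "S_sum m s H (alpha {1..n} t (deg_T L) s (deg_S H) u)
           + T_sum n t H (alpha {1..m} s (deg_S L) t (deg_T H) v)"
  let ?N = "real (card (\<B> m n s t H L))"
  let ?N1 = "real (card (\<B> m n s t (insert (u, v) H) L))"
  obtain G where G: "G \<in> \<B> m n s t H L" using assms by auto
  have k: "?k > 0" using assms by simp
  have r0: "r \<ge> 0" unfolding r_def using assms by simp
  define Q where "Q = q m n s t H L (u, v)"
  have Q: "Q = 1 - ?st / ?k" unfolding Q_def q.simps ..
  have "?st \<ge> 0"
    using S_sum_nonneg[OF G L] T_sum_nonneg[OF G L] by (intro add_nonneg_nonneg) (simp_all add: alpha_nonneg)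
  then have Q1: "Q \<le> 1" unfolding Q using k by simp
  have "(?N - ?N1) * (?ab * (?k - ?st)) \<le> ?N1 * ?k\<^sup>2"
    using three_switch_count[OF assms(1-4)] unfolding card_\<B>_split by (simp only: \<B>_insert)
  moreover have "?ab * (?k - ?st) = r * Q * ?k\<^sup>2"
  proof -
    have "y * (k - z) = y / k * (1 - z / k) * k\<^sup>2" if "k > 0" for y z k :: real
      using that by (simp add: field_simps power2_eq_square)
    then show ?thesis unfolding Q r_def using k by blast
  qed
  ultimately have "((?N - ?N1) * (r * Q)) * ?k\<^sup>2 \<le> ?N1 * ?k\<^sup>2"
    by (simp only: mult.assoc)
  then have "(?N - ?N1) * (r * Q) \<le> ?N1"
    using k by (simp only: mult_le_cancel_right_pos zero_less_power)
  then have "?N * (r * Q) \<le> ?N1 * (1 + r * Q)"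
    by (simp only: algebra_simps)
  \<comment> \<open>Since Q \<le> 1, the denominator 1 + r Q may be enlarged to 1 + r, which no
    longer involves \<open>q\<close>.\<close>
  also have "\<dots> \<le> ?N1 * (1 + r)"
    using r0 Q1 by (intro mult_left_mono) (simp_all add: mult_left_le)
  finally show ?thesis
    unfolding Q_def using r0 by (simp add: field_simps)
qed

text \<open>With one free edge left, the residual degree of \<open>u\<close> is 1. Moreover
  \<alpha>_u is at least t_v, hence at least 1, so S_H(\<alpha>_u) is already as large as the
  denominator 1.\<close>

lemma q_last_edge_nonpos:
  assumes L: "L \<subseteq> K m n" and "(u, v) \<in> K m n" "\<B> m n s t H L \<noteq> {}"
    and "num_edges m s = Suc (card H)" "deg_S H u < s u" "deg_T H v < t v"
  shows "q m n s t H L (u, v) \<le> 0"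
proof -
  obtain G where G: "G \<in> \<B> m n s t H L" using assms by auto
  note r = residual_degrees[OF G L]
  have uv: "u \<in> {1..m}" "v \<in> {1..n}" using assms by (auto simp: K_def)
  have fin: "finite (G - H)" using r(1) by simp
  have "deg_S (G - H) u \<le> card (G - H)"
    unfolding deg_S_eq_card using fin by (intro card_mono) auto
  then have "real (deg_S (G - H) u) \<le> 1" using r(7) assms(4) by simp
  then have one: "real (s u) - real (deg_S H u) = 1" using r(3)[OF uv(1)] assms(5) by linarith
  have "alpha {1..n} t (deg_T L) s (deg_S H) u = D {1..n} (\<lambda>i. int (t i) + int (deg_T L i)) 1"
    by (simp add: alpha_def one)
  moreover have "real_of_int (int (t v) + int (deg_T L v)) \<le> D {1..n} (\<lambda>i. int (t i) + int (deg_T L i)) 1"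
    using sum_le_D[of "{1..n}" "\<lambda>i. int (t i) + int (deg_T L i)" "{v}" 1] uv by simp
  ultimately have "alpha {1..n} t (deg_T L) s (deg_S H) u \<ge> 1"
    using assms(6) by simp
  then have "real_of_int (int (s u) - int (deg_S H u)) \<le> S_sum m s H (alpha {1..n} t (deg_T L) s (deg_S H) u)"
    using sum_le_D[of "{1..m}" "\<lambda>u. int (s u) - int (deg_S H u)" "{u}"] r(3) uv
    by (simp add: S_sum_def)
  moreover have "0 \<le> T_sum n t H (alpha {1..m} s (deg_S L) t (deg_T H) v)"
    by (rule T_sum_nonneg[OF G L]) (simp add: alpha_nonneg)
  ultimately show ?thesis
    using one assms(4) by simp
qed

subsection \<open>Enumerating the edges of X\<close>

lemma falling_Suc: "falling x (Suc i) = falling x i * (x - real i)"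
  by (simp add: falling_def)

lemma falling_pos: "i \<le> x \<Longrightarrow> 0 < falling (real x) i"
  unfolding falling_def by (intro prod_pos) auto

lemma falling_eq_0: "x < i \<Longrightarrow> falling (real x) i = 0"
  unfolding falling_def by (rule prod_zero) auto

lemma falling_nonneg: "0 \<le> falling (real x) i"
  using falling_pos[of i x] falling_eq_0[of x i] by (cases "i \<le> x") (auto simp: less_imp_le)

text \<open>The numerator of both bounds, stated for an arbitrary graph so that it can be followed
  through the partial graphs X_i.\<close>

definition deg_falling :: "nat \<Rightarrow> nat \<Rightarrow> (nat \<Rightarrow> nat) \<Rightarrow> (nat \<Rightarrow> nat) \<Rightarrow> bgraph \<Rightarrow> real" where
  "deg_falling m n s t H
    = (\<Prod>i=1..m. falling (s i) (deg_S H i)) * (\<Prod>j=1..n. falling (t j) (deg_T H j))"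

lemma deg_falling_nonneg: "0 \<le> deg_falling m n s t H"
  unfolding deg_falling_def by (intro mult_nonneg_nonneg prod_nonneg) (auto simp: falling_nonneg)

lemma prod_falling_add_indicator:
  assumes "finite V" "u \<in> V"
  shows "(\<Prod>i\<in>V. falling (g i) (h i + of_bool (i = u))) = (\<Prod>i\<in>V. falling (g i) (h i)) * (g u - real (h u))"
proof -
  have "(\<Prod>i\<in>V. falling (g i) (h i + of_bool (i = u)))
      = (\<Prod>i\<in>V. falling (g i) (h i) * (if i = u then g u - real (h u) else 1))"
    by (intro prod.cong) (auto simp: falling_Suc)
  then show ?thesis
    using assms by (simp add: prod.distrib prod.delta)
qed

lemma deg_falling_insert:
  assumes "finite H" "(u, v) \<notin> H" "(u, v) \<in> K m n"
  shows "deg_falling m n s t (insert (u, v) H)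
    = deg_falling m n s t H * ((real (s u) - real (deg_S H u)) * (real (t v) - real (deg_T H v)))"
  using assms prod_falling_add_indicator[of "{1..m}" u "\<lambda>i. real (s i)" "deg_S H"]
    prod_falling_add_indicator[of "{1..n}" v "\<lambda>i. real (t i)" "deg_T H"]
  unfolding deg_falling_def by (simp add: deg_S_insert deg_T_insert K_def)

lemma deg_falling_pos_D:
  assumes "deg_falling m n s t H \<noteq> 0"
  shows "u \<in> {1..m} \<Longrightarrow> deg_S H u \<le> s u" "v \<in> {1..n} \<Longrightarrow> deg_T H v \<le> t v"
proof -
  have "falling (s i) (deg_S H i) \<noteq> 0" if "i \<in> {1..m}" for i
    using assms that by (auto simp: deg_falling_def)
  moreover have "falling (t i) (deg_T H i) \<noteq> 0" if "i \<in> {1..n}" for i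
    using assms that by (auto simp: deg_falling_def)
  ultimately show "u \<in> {1..m} \<Longrightarrow> deg_S H u \<le> s u" "v \<in> {1..n} \<Longrightarrow> deg_T H v \<le> t v"
    using falling_eq_0 by (meson not_le)+
qed

text \<open>The arithmetic-geometric mean inequality with a power of the mean instead of a root of
  the product.\<close>

lemma prod_le_mean_power:
  fixes x :: "'a \<Rightarrow> real"
  assumes "finite S" "\<And>i. i \<in> S \<Longrightarrow> 0 \<le> x i"
  shows "(\<Prod>i\<in>S. x i) \<le> ((\<Sum>i\<in>S. x i) / card S) ^ card S"
proof (cases "S = {}")
  case False
  let ?P = "\<Prod>i\<in>S. x i"
  have P: "?P \<ge> 0" using assms by (intro prod_nonneg) auto
  have c: "card S > 0" using False assms(1) by (simp add: card_gt_0_iff)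
  have "?P = (?P powr (1 / card S)) ^ card S"
    using P c by (cases "?P = 0") (auto simp: powr_realpow[symmetric] powr_powr)
  also have "\<dots> \<le> (\<Sum>i\<in>S. x i / card S) ^ card S"
    using arith_geom_mean[OF assms(1) False, of x] assms(2) by (intro power_mono) auto
  finally show ?thesis by (simp add: sum_divide_distrib)
qed simp

section \<open>The enumeration e_1, e_2, ... and its partial graphs\<close>

locale edge_enumeration =
  fixes m n :: nat and s t :: "nat \<Rightarrow> nat" and X L :: bgraph and e :: "nat \<Rightarrow> nat \<times> nat"
  assumes X: "X \<subseteq> K m n" and L: "L \<subseteq> K m n" and XL: "X \<inter> L = {}"
    and ne: "\<B> m n s t {} L \<noteq> {}"
    and e: "bij_betw e {1..card X} X"
begin

definition H :: "nat \<Rightarrow> bgraph" where "H i = e ` {1..i}"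
definition N :: "nat \<Rightarrow> real" where "N i = real (card (\<B> m n s t (H i) L))"
definition M :: real where "M = real (num_edges m s)"
text \<open>Indices start at 0: \<open>H i\<close> is X_i, while \<open>a i\<close> and
  \<open>b i\<close> are the residual degrees at the ends of the next edge
  \<open>e (Suc i)\<close>.\<close>

definition a :: "nat \<Rightarrow> real" where
  "a i = real (s (fst (e (Suc i)))) - real (deg_S (H i) (fst (e (Suc i))))"
definition b :: "nat \<Rightarrow> real" where
  "b i = real (t (snd (e (Suc i)))) - real (deg_T (H i) (snd (e (Suc i))))"

lemma H_Suc: "H (Suc i) = insert (e (Suc i)) (H i)"
  by (simp add: H_def atLeastAtMostSuc_conv)

lemma H_0: "H 0 = {}"
  by (simp add: H_def)

lemma H_card_X: "H (card X) = X"
  using e by (simp add: H_def bij_betw_def)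

lemma H_subset: "i \<le> card X \<Longrightarrow> H i \<subseteq> X"
  using bij_betw_imp_surj_on[OF e] by (auto simp: H_def)

lemma finite_X: "finite X"
  using X finite_K finite_subset by blast

lemma card_H: "i \<le> card X \<Longrightarrow> card (H i) = i"
  unfolding H_def using e by (subst card_image) (auto simp: bij_betw_def intro: inj_on_subset)

lemma e_Suc:
  assumes "i < card X"
  shows "e (Suc i) \<in> K m n" "e (Suc i) \<notin> L" "e (Suc i) \<notin> H i" "finite (H i)"
proof -
  have "e (Suc i) \<in> X" using assms bij_betwE[OF e] by auto
  then show "e (Suc i) \<in> K m n" "e (Suc i) \<notin> L" using X XL by auto
  show "e (Suc i) \<notin> H i"
    using inj_onD[OF bij_betw_imp_inj_on[OF e], of "Suc i"] assms by (force simp: H_def)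
qed (simp add: H_def)

lemma deg_falling_H_Suc:
  assumes "i < card X"
  shows "deg_falling m n s t (H (Suc i)) = deg_falling m n s t (H i) * (a i * b i)"
  using e_Suc[OF assms] deg_falling_insert[of "H i" "fst (e (Suc i))" "snd (e (Suc i))" m n s t]
  by (simp add: H_Suc a_def b_def)

lemma N_0_pos: "N 0 > 0"
  using ne finite_\<B>[of m n s t "{}" L] by (simp add: N_def H_0 card_gt_0_iff)

lemma prob_eq: "measure_pmf.prob (pmf_of_set (\<B> m n s t {} L)) {G. X \<subseteq> G} = N (card X) / N 0"
proof -
  have "\<B> m n s t {} L \<inter> {G. X \<subseteq> G} = \<B> m n s t X L" by (auto simp: \<B>_def)
  then show ?thesis
    using ne by (simp add: measure_pmf_of_set finite_\<B> N_def H_card_X H_0)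
qed

section \<open>Upper bound along the enumeration\<close>

lemma upper_step:
  assumes "i < card X" "N (Suc i) \<noteq> 0" "p m n s t (H i) L (e (Suc i)) > 0"
  shows "N (Suc i) \<le> N i * (a i * b i) / ((M - real i) * p m n s t (H i) L (e (Suc i)))"
proof -
  have "\<B> m n s t (insert (e (Suc i)) (H i)) L \<noteq> {}"
    using assms(2) by (auto simp: N_def H_Suc)
  then show ?thesis
    using edge_upper_bound[of L m n "fst (e (Suc i))" "snd (e (Suc i))" "H i" s t] L e_Suc[OF assms(1)] assms
    by (simp add: N_def H_Suc a_def b_def M_def card_H)
qed

lemma ratio_nonneg:
  assumes i: "i < card X" and "N (Suc i) \<noteq> 0"
  shows "0 \<le> a i * b i / (M - real i)"
proof -
  have "\<B> m n s t (insert (e (Suc i)) (H i)) L \<noteq> {}"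
    using assms(2) by (auto simp: N_def H_Suc)
  then obtain G where G': "G \<in> \<B> m n s t (insert (e (Suc i)) (H i)) L"
    by (meson all_not_in_conv)
  then have G: "G \<in> \<B> m n s t (H i) L" by (simp add: \<B>_insert)
  have "fst (e (Suc i)) \<in> {1..m}" "snd (e (Suc i)) \<in> {1..n}"
    using e_Suc(1)[OF i] by (auto simp: K_def mem_Times_iff)
  then have "a i \<ge> 0" "b i \<ge> 0"
    using residual_degrees(3)[OF G L, of "fst (e (Suc i))"]
      residual_degrees(4)[OF G L, of "snd (e (Suc i))"]
    unfolding a_def b_def by linarith+
  moreover have "M - real i > 0"
    using card_less_num_edges[OF G' e_Suc(3)[OF i]] card_H[of i] i by (simp add: M_def)
  ultimately show ?thesis by simp
qed

text \<open>The one-edge bounds multiply: the factors \<open>a i * b i\<close> build up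
  \<open>deg_falling\<close>, and the factors \<open>M - real i\<close> build up the falling
  factorial of \<open>M\<close>.\<close>

lemma upper_bound:
  assumes "\<And>i. i < card X \<Longrightarrow> p m n s t (H i) L (e (Suc i)) > 0" "i \<le> card X"
  shows "N i \<le> N 0 * (deg_falling m n s t (H i) / falling M i
    * (\<Prod>j<i. 1 / p m n s t (H j) L (e (Suc j))))"
  using assms(2)
proof (induction i)
  case 0
  have "deg_falling m n s t {} = 1"
    by (simp add: deg_falling_def deg_S_def deg_T_def falling_def)
  then show ?case by (simp add: H_0 falling_def)
next
  case (Suc i)
  let ?R = "\<lambda>i. deg_falling m n s t (H i) / falling M i * (\<Prod>j<i. 1 / p m n s t (H j) L (e (Suc j)))"
  let ?p = "p m n s t (H i) L (e (Suc i))"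
  have i: "i < card X" using Suc by simp
  show ?case
  proof (cases "N (Suc i) = 0")
    case True
    \<comment> \<open>Without graphs left, nonnegativity of the right side suffices. It holds even
      if the falling factorial is 0, as division by zero yields 0.\<close>
    have "0 \<le> ?R (Suc i)"
      using assms(1) Suc(2)
      by (intro mult_nonneg_nonneg divide_nonneg_nonneg deg_falling_nonneg prod_nonneg)
        (auto simp: M_def falling_nonneg less_imp_le)
    then show ?thesis
      unfolding True using mult_nonneg_nonneg[OF less_imp_le[OF N_0_pos]] by blast
  next
    case False
    have c0: "0 \<le> a i * b i / ((M - real i) * ?p)"
      using ratio_nonneg[OF i False] assms(1)[OF i] by (simp only: divide_divide_eq_left[symmetric] divide_nonneg_pos)
    have "N (Suc i) \<le> N i * (a i * b i / ((M - real i) * ?p))"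
      using upper_step[OF i False assms(1)[OF i]] by simp
    also have "\<dots> \<le> N 0 * ?R i * (a i * b i / ((M - real i) * ?p))"
      using Suc c0 by (intro mult_right_mono) auto
    also have "\<dots> = N 0 * ?R (Suc i)"
      by (simp add: deg_falling_H_Suc[OF i] falling_Suc mult_ac)
    finally show ?thesis .
  qed
qed

definition r :: "nat \<Rightarrow> real" where "r i = a i * b i / (M - real i)"

section \<open>Lower bound along the enumeration, for a nonzero numerator\<close>

context
  assumes deg_falling_neq_0: "deg_falling m n s t X \<noteq> 0"
    and q_pos: "\<And>i. i < card X \<Longrightarrow> q m n s t (H i) L (e (Suc i)) > 0"
begin

lemma card_X_le: "card X \<le> num_edges m s"
proof -
  have "{x \<in> X. fst x \<in> {1..m}} = X" using X by (auto simp: K_def)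
  then have "card X = (\<Sum>u=1..m. deg_S X u)"
    using card_edges_into[OF finite_X, of "{1..m}"] by simp
  also have "\<dots> \<le> (\<Sum>u=1..m. s u)"
    using deg_falling_pos_D(1)[OF deg_falling_neq_0] by (intro sum_mono) auto
  finally show ?thesis by (simp add: num_edges_def)
qed

text \<open>The next edge belongs to \<open>X\<close> but not to \<open>H i\<close>, so at its ends
  \<open>H i\<close> has smaller degree than \<open>X\<close>, and the nonzero numerator bounds the
  degrees of \<open>X\<close> by \<open>s\<close> and \<open>t\<close>.\<close>

lemma residual_degrees_pos:
  assumes "i < card X"
  shows "deg_S (H i) (fst (e (Suc i))) < s (fst (e (Suc i)))"
    and "deg_T (H i) (snd (e (Suc i))) < t (snd (e (Suc i)))"
proof -
  obtain u v where uv: "e (Suc i) = (u, v)" by (cases "e (Suc i)")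
  note ei = e_Suc[OF assms, unfolded uv]
  have sub: "insert (u, v) (H i) \<subseteq> X" using H_subset[of "Suc i"] assms by (simp add: H_Suc uv)
  have "deg_S (H i) u < deg_S X u"
    using deg_S_mono[OF finite_X sub, of u] deg_S_insert[OF ei(4,3), of u] by simp
  moreover have "(insert (u, v) (H i))\<inverse> \<subseteq> X\<inverse>" using sub by blast
  then have "deg_T (insert (u, v) (H i)) v \<le> deg_T X v"
    unfolding deg_T_eq_converse using finite_X by (intro deg_S_mono) auto
  then have "deg_T (H i) v < deg_T X v"
    using deg_T_insert[OF ei(4,3), of v] by simp
  ultimately show "deg_S (H i) (fst (e (Suc i))) < s (fst (e (Suc i)))"
    "deg_T (H i) (snd (e (Suc i))) < t (snd (e (Suc i)))"
    using deg_falling_pos_D[OF deg_falling_neq_0] ei(1) unfolding uv K_def by force+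
qed

lemma a_b_pos: "i < card X \<Longrightarrow> 0 < a i" "i < card X \<Longrightarrow> 0 < b i"
  using residual_degrees_pos[of i] by (simp_all add: a_def b_def)

lemma M_minus_pos: "i < card X \<Longrightarrow> 0 < M - real i"
  using card_X_le by (simp add: M_def)

lemma r_pos: "i < card X \<Longrightarrow> 0 < r i"
  unfolding r_def using a_b_pos M_minus_pos by simp

lemma lower_step:
  assumes "i < card X" "N i > 0"
  shows "N i * (r i * q m n s t (H i) L (e (Suc i)) / (1 + r i)) \<le> N (Suc i)"
proof -
  have "\<B> m n s t (H i) L \<noteq> {}" using assms(2) by (auto simp: N_def)
  then show ?thesis
    using edge_lower_bound[OF L, of "fst (e (Suc i))" "snd (e (Suc i))" "H i" s t]
      e_Suc[OF assms(1)] assms card_H[of i] card_X_le residual_degrees_pos[OF assms(1)]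
    by (simp add: N_def H_Suc r_def a_def b_def M_def)
qed

text \<open>Positivity of \<open>R\<close> is carried along in the induction: it shows that some
  graph contains \<open>H i\<close>, as required for adding the next edge.\<close>

lemma lower_bound:
  assumes "i \<le> card X"
  defines "R \<equiv> deg_falling m n s t (H i) / falling M i
    * (\<Prod>j<i. q m n s t (H j) L (e (Suc j)) / (1 + r j))"
  shows "0 < R \<and> N 0 * R \<le> N i"
  using assms(1) unfolding R_def
proof (induction i)
  case 0
  have "deg_falling m n s t {} = 1"
    by (simp add: deg_falling_def deg_S_def deg_T_def falling_def)
  then show ?case by (simp add: H_0 falling_def)
next
  case (Suc i)
  let ?R = "\<lambda>i. deg_falling m n s t (H i) / falling M i
    * (\<Prod>j<i. q m n s t (H j) L (e (Suc j)) / (1 + r j))"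
  let ?c = "r i * q m n s t (H i) L (e (Suc i)) / (1 + r i)"
  have i: "i < card X" using Suc by simp
  then have IH: "0 < ?R i" "N 0 * ?R i \<le> N i" using Suc by simp_all
  then have Ni: "N i > 0" using N_0_pos mult_pos_pos less_le_trans by blast
  have c: "0 < ?c" using r_pos[OF i] q_pos[OF i] by simp
  have eq: "?R (Suc i) = ?R i * ?c"
    by (simp add: deg_falling_H_Suc[OF i] falling_Suc r_def[of i] mult_ac)
  have "N 0 * (?R i * ?c) \<le> N i * ?c"
    using mult_right_mono[OF IH(2), of ?c] c by (simp only: mult.assoc less_imp_le)
  also have "\<dots> \<le> N (Suc i)"
    by (rule lower_step[OF i Ni])
  finally show ?case
    unfolding eq using mult_pos_pos[OF IH(1) c] by blast
qed

text \<open>If \<open>X\<close> used up all edges, then adding its last edge would have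
  \<open>q\<close> at most 0 by \<open>q_last_edge_nonpos\<close>. This makes the denominator in
  \<phi>' positive.\<close>

lemma card_X_less:
  assumes "X \<noteq> {}"
  shows "card X < num_edges m s"
proof (rule ccontr)
  assume "\<not> card X < num_edges m s"
  then have eq: "num_edges m s = card X" using card_X_le by simp
  obtain i where i: "card X = Suc i" using assms finite_X by (cases "card X") auto
  then have iX: "i < card X" by simp
  have "N i > 0"
    using lower_bound[of i] iX N_0_pos mult_pos_pos less_le_trans by (meson less_imp_le)
  then have "\<B> m n s t (H i) L \<noteq> {}" by (auto simp: N_def)
  then have "q m n s t (H i) L (e (Suc i)) \<le> 0"
    using q_last_edge_nonpos[OF L, of "fst (e (Suc i))" "snd (e (Suc i))" s t "H i"]
      e_Suc[OF iX] residual_degrees_pos[OF iX] card_H[of i] iX i eq by simp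
  then show False using q_pos[OF iX] by simp
qed

text \<open>Residual degrees are at most full degrees, and M - j \<ge> M - k. After these estimates,
  the mean of the factors over the edges of \<open>X\<close> is exactly \<phi>'.\<close>

lemma prod_one_plus_r_le: "(\<Prod>j<card X. 1 + r j) \<le> \<phi>' m s t X ^ card X"
proof (cases "X = {}")
  case False
  define k where "k = card X"
  have k: "k > 0" using False finite_X by (simp add: k_def card_gt_0_iff)
  have Mk: "M - real k > 0" using card_X_less[OF False] by (simp add: M_def k_def)
  define st where "st j = real (s (fst (e (Suc j)))) * real (t (snd (e (Suc j))))" for j
  have "r j \<le> st j / (M - real k)" if "j < k" for j
  proof -
    have "a j * b j \<le> st j"
      unfolding st_def using a_b_pos[of j] that
      by (intro mult_mono) (auto simp: a_def b_def k_def)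
    then show ?thesis
      unfolding r_def using Mk that by (intro frac_le) (auto simp: st_def)
  qed
  then have "(\<Prod>j<k. 1 + r j) \<le> (\<Prod>j<k. 1 + st j / (M - real k))"
    using r_pos by (intro prod_mono) (auto simp: k_def less_imp_le add_nonneg_nonneg)
  also have "\<dots> \<le> ((\<Sum>j<k. 1 + st j / (M - real k)) / k) ^ k"
    using prod_le_mean_power[of "{..<k}" "\<lambda>j. 1 + st j / (M - real k)"] Mk by (simp add: st_def)
  also have "(\<Sum>j<k. st j) = (\<Sum>(u, v)\<in>X. real (s u) * real (t v))"
    using sum.reindex_bij_betw[OF e, of "\<lambda>(u, v). real (s u) * real (t v)"]
    by (simp add: st_def k_def case_prod_beta sum.atLeast1_atMost_eq)
  then have "(\<Sum>j<k. 1 + st j / (M - real k)) / k = \<phi>' m s t X"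
    using k by (simp add: \<phi>'_def sum.distrib sum_divide_distrib[symmetric] k_def M_def add_divide_distrib mult.commute)
  finally show ?thesis by (simp add: k_def)
qed simp

lemma lower_bound_prob:
  "deg_falling m n s t X / falling M (card X) * (\<Prod>j<card X. q m n s t (H j) L (e (Suc j)) / \<phi>' m s t X)
    \<le> N (card X) / N 0"
proof -
  let ?q = "\<Prod>j<card X. q m n s t (H j) L (e (Suc j))"
  let ?d = "deg_falling m n s t X / falling M (card X)"
  have P: "(\<Prod>j<card X. 1 + r j) > 0" using r_pos by (intro prod_pos) (auto intro: add_pos_pos)
  have d: "?d \<ge> 0" unfolding M_def by (intro divide_nonneg_nonneg deg_falling_nonneg falling_nonneg)
  have "?q \<ge> 0" using q_pos by (intro prod_nonneg) (auto simp: less_imp_le)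
  then have "?q / \<phi>' m s t X ^ card X \<le> ?q / (\<Prod>j<card X. 1 + r j)"
    using prod_one_plus_r_le P by (intro divide_left_mono mult_pos_pos) auto
  then have "?d * (?q / \<phi>' m s t X ^ card X) \<le> ?d * (?q / (\<Prod>j<card X. 1 + r j))"
    using d by (rule mult_left_mono)
  also have "\<dots> \<le> N (card X) / N 0"
    using lower_bound[of "card X"] N_0_pos
    by (simp add: pos_le_divide_eq H_card_X prod_dividef mult.commute)
  finally show ?thesis by (simp add: prod_dividef)
qed

end

end

theorem mainTheorem7:
  fixes m n :: nat and s t :: "nat \<Rightarrow> nat" and X L :: bgraph and e :: "nat \<Rightarrow> nat \<times> nat"
  assumes "X \<subseteq> K m n" and "L \<subseteq> K m n" and "X \<inter> L = {}"
    and "\<B> m n s t {} L \<noteq> {}"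
    and "bij_betw e {1..card X} X"
  shows "((\<forall>i\<in>{1..card X}. p m n s t (e ` {1..i - 1}) L (e i) > 0) \<longrightarrow>
      measure_pmf.prob (pmf_of_set (\<B> m n s t {} L)) {G. X \<subseteq> G}
        \<le> (\<Prod>i=1..m. falling (s i) (deg_S X i)) * (\<Prod>j=1..n. falling (t j) (deg_T X j))
            / falling (num_edges m s) (card X)
          * (\<Prod>i=1..card X. 1 / p m n s t (e ` {1..i - 1}) L (e i)))
    \<and> ((\<forall>i\<in>{1..card X}. q m n s t (e ` {1..i - 1}) L (e i) > 0) \<longrightarrow>
      measure_pmf.prob (pmf_of_set (\<B> m n s t {} L)) {G. X \<subseteq> G}
        \<ge> (\<Prod>i=1..m. falling (s i) (deg_S X i)) * (\<Prod>j=1..n. falling (t j) (deg_T X j))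
            / falling (num_edges m s) (card X)
          * (\<Prod>i=1..card X. q m n s t (e ` {1..i - 1}) L (e i) / \<phi>' m s t X))"
proof -
  interpret edge_enumeration m n s t X L e
    using assms by unfold_locales
  \<comment> \<open>The index i of the statement is j + 1 here, so X_{i-1} is
    \<open>H j\<close>.\<close>
  have shift: "(\<Prod>i=1..card X. f (e ` {1..i - 1}) (e i)) = (\<Prod>j<card X. f (H j) (e (Suc j)))"
    for f :: "bgraph \<Rightarrow> nat \<times> nat \<Rightarrow> real"
    by (simp add: prod.atLeast1_atMost_eq H_def)
  have upper: "measure_pmf.prob (pmf_of_set (\<B> m n s t {} L)) {G. X \<subseteq> G}
      \<le> deg_falling m n s t X / falling M (card X)
        * (\<Prod>i=1..card X. 1 / p m n s t (e ` {1..i - 1}) L (e i))"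
    if "\<forall>i\<in>{1..card X}. p m n s t (e ` {1..i - 1}) L (e i) > 0"
  proof -
    have "p m n s t (H i) L (e (Suc i)) > 0" if "i < card X" for i
      using \<open>\<forall>i\<in>_. _\<close>[rule_format, of "Suc i"] that by (simp add: H_def)
    from upper_bound[OF this, of "card X"] show ?thesis
      unfolding prob_eq shift[of "\<lambda>H e. 1 / p m n s t H L e"]
      using N_0_pos by (simp add: H_card_X pos_divide_le_eq mult.commute)
  qed
  have lower: "deg_falling m n s t X / falling M (card X)
        * (\<Prod>i=1..card X. q m n s t (e ` {1..i - 1}) L (e i) / \<phi>' m s t X)
      \<le> measure_pmf.prob (pmf_of_set (\<B> m n s t {} L)) {G. X \<subseteq> G}"
    if "\<forall>i\<in>{1..card X}. q m n s t (e ` {1..i - 1}) L (e i) > 0"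
  \<comment> \<open>A vanishing numerator makes the lower bound 0, which any probability
    satisfies.\<close>
  proof (cases "deg_falling m n s t X = 0")
    case False
    have "q m n s t (H i) L (e (Suc i)) > 0" if "i < card X" for i
      using \<open>\<forall>i\<in>_. _\<close>[rule_format, of "Suc i"] that by (simp add: H_def)
    from lower_bound_prob[OF False this] show ?thesis
      unfolding prob_eq shift[of "\<lambda>H e. q m n s t H L e / \<phi>' m s t X"] .
  qed simp
  show ?thesis
    using upper lower unfolding deg_falling_def M_def by blast
qed

end
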